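(* For any $R_\theta$-invariant star body $K$ in $\mathbb{R}^4$ contained in the unit ball, the distribution $$\frac{\|x\|_K^{-2}}{1-\left(\frac{|x|}{\|x\|_K}\right)^2}$$ on $\mathbb{R}^4$ is positive definite.
   Context: $|\cdot|$ is the Euclidean norm; "unit ball" means the open Euclidean unit ball $\{|x|<1\}$. A star body is a compact set $K$, having the origin as an interior point, such that every line through the origin crosses the boundary of $K$ in exactly two points different from the origin. Its Minkowski functional is $\|x\|_K=\min\{a\ge 0:x\in aK\}$. Writing points of $\mathbb{R}^{4}$ as $\xi=(\xi_{11},\xi_{12},\xi_{21},\xi_{22})$, a body $K$ is $R_\theta$-invariant if for every $\theta\in[0,2\pi]$ and every $\xi\in\mathbb{R}^4$, $\|\xi\|_K=\|(R_\theta(\xi_{11},\xi_{12}),R_\theta(\xi_{21},\xi_{22}))\|_K$, where $R_\theta$ is the counterclockwise rotation of $\mathbb{R}^2$ by the angle $\theta$ about the origin. The displayed function is locally integrable on $\mathbb{R}^4$, homogeneous of degree $-2$, and is regarded as a tempered distribution. A distribution $f$ is positive definite if $\langle f,\varphi*\overline{\varphi}(-x)\rangle\ge 0$ for every Schwartz test function $\varphi$; equivalently, its Fourier transform satisfies $\langle\hat f,\varphi\rangle\ge 0$ for every non-negative test function $\varphi$. *)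

theory Defs
  imports "HOL-Analysis.Analysis"
begin

section \<open>Star bodies\<close>

definition star_body :: "'a::euclidean_space set \<Rightarrow> bool" where
  "star_body K \<longleftrightarrow>
     compact K \<and> 0 \<in> interior K \<and>
     (\<forall>u. u \<noteq> 0 \<longrightarrow> card (span {u} \<inter> frontier K - {0}) = 2)"

text \<open>\<open>LEAST\<close> is only meaningful if the minimum is attained, which is the case for star bodies.\<close>

definition minkowski_functional :: "'a::real_vector set \<Rightarrow> 'a \<Rightarrow> real" where
  "minkowski_functional K x = (LEAST a. 0 \<le> a \<and> x \<in> (\<lambda>y. a *\<^sub>R y) ` K)"

definition rot2 :: "real \<Rightarrow> real \<times> real \<Rightarrow> real \<times> real" where
  "rot2 \<theta> = (\<lambda>(a, b). (cos \<theta> * a - sin \<theta> * b, sin \<theta> * a + cos \<theta> * b))"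

text \<open>The coordinates \<open>\<xi>\<^sub>1\<^sub>1, \<xi>\<^sub>1\<^sub>2, \<xi>\<^sub>2\<^sub>1, \<xi>\<^sub>2\<^sub>2\<close> are the components \<open>1, 2, 3, 4\<close>,
  so the pairs rotated simultaneously are \<open>(1, 2)\<close> and \<open>(3, 4)\<close>.\<close>

definition rot4 :: "real \<Rightarrow> real ^ 4 \<Rightarrow> real ^ 4" where
  "rot4 \<theta> x =
     (let (a, b) = rot2 \<theta> (x $ 1, x $ 2); (c, d) = rot2 \<theta> (x $ 3, x $ 4)
      in vector [a, b, c, d])"

lemma rot4_nth:
  "rot4 \<theta> x $ 1 = cos \<theta> * x $ 1 - sin \<theta> * x $ 2"
  "rot4 \<theta> x $ 2 = sin \<theta> * x $ 1 + cos \<theta> * x $ 2"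
  "rot4 \<theta> x $ 3 = cos \<theta> * x $ 3 - sin \<theta> * x $ 4"
  "rot4 \<theta> x $ 4 = sin \<theta> * x $ 3 + cos \<theta> * x $ 4"
  by (simp_all add: rot4_def rot2_def vector_def)

definition rotation_invariant :: "(real ^ 4) set \<Rightarrow> bool" where
  "rotation_invariant K \<longleftrightarrow>
     (\<forall>\<theta>\<in>{0..2 * pi}. \<forall>\<xi>. minkowski_functional K \<xi> = minkowski_functional K (rot4 \<theta> \<xi>))"

section \<open>Schwartz functions and tempered distributions\<close>

primrec iterated_partial :: "'a list \<Rightarrow> ('a::euclidean_space \<Rightarrow> complex) \<Rightarrow> 'a \<Rightarrow> complex" where
  "iterated_partial [] \<phi> = \<phi>"
| "iterated_partial (b # bs) \<phi> = (\<lambda>x. frechet_derivative (iterated_partial bs \<phi>) (at x) b)"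

text \<open>Smoothness is expressed by differentiability of all iterated partial derivatives along
  the standard basis; each list \<open>bs\<close> of basis vectors plays the role of a multi-index.\<close>

definition schwartz :: "('a::euclidean_space \<Rightarrow> complex) set" where
  "schwartz = {\<phi>. \<forall>bs. set bs \<subseteq> Basis \<longrightarrow>
     (\<forall>x. iterated_partial bs \<phi> differentiable (at x)) \<and>
     (\<forall>k::nat. bounded (range (\<lambda>x. (1 + norm x) ^ k *\<^sub>R iterated_partial bs \<phi> x)))}"

definition schwartz_norm :: "nat \<Rightarrow> ('a::euclidean_space \<Rightarrow> complex) \<Rightarrow> real" where
  "schwartz_norm N \<phi> =
     (SUP (bs, x) \<in> {bs. set bs \<subseteq> Basis \<and> length bs \<le> N} \<times> UNIV.
        (1 + norm x) ^ N * norm (iterated_partial bs \<phi> x))"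

text \<open>Functionals are total functions in HOL; only their values on \<open>schwartz\<close> matter.\<close>

definition tempered_distribution :: "(('a::euclidean_space \<Rightarrow> complex) \<Rightarrow> complex) \<Rightarrow> bool" where
  "tempered_distribution T \<longleftrightarrow>
     (\<forall>\<phi>\<in>schwartz. \<forall>\<psi>\<in>schwartz. T (\<lambda>x. \<phi> x + \<psi> x) = T \<phi> + T \<psi>) \<and>
     (\<forall>c. \<forall>\<phi>\<in>schwartz. T (\<lambda>x. c * \<phi> x) = c * T \<phi>) \<and>
     (\<exists>N C. \<forall>\<phi>\<in>schwartz. norm (T \<phi>) \<le> C * schwartz_norm N \<phi>)"

definition distribution_of :: "('a::euclidean_space \<Rightarrow> real) \<Rightarrow> ('a \<Rightarrow> complex) \<Rightarrow> complex" where
  "distribution_of f \<phi> = (LINT x|lborel. f x *\<^sub>R \<phi> x)"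

definition locally_integrable :: "('a::euclidean_space \<Rightarrow> real) \<Rightarrow> bool" where
  "locally_integrable f \<longleftrightarrow> (\<forall>C. compact C \<longrightarrow> set_integrable lborel C f)"

text \<open>The integrability condition is stated separately because the Bochner integral of a
  non-integrable function is \<open>0\<close>.\<close>

definition induces_tempered_distribution :: "('a::euclidean_space \<Rightarrow> real) \<Rightarrow> bool" where
  "induces_tempered_distribution f \<longleftrightarrow>
     locally_integrable f \<and>
     (\<forall>\<phi>\<in>schwartz. integrable lborel (\<lambda>x. f x *\<^sub>R \<phi> x)) \<and>
     tempered_distribution (distribution_of f)"

definition convolution ::
  "('a::euclidean_space \<Rightarrow> complex) \<Rightarrow> ('a \<Rightarrow> complex) \<Rightarrow> 'a \<Rightarrow> complex" where
  "convolution \<phi> \<psi> x = (LINT y|lborel. \<phi> y * \<psi> (x - y))"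

definition positive_definite :: "(('a::euclidean_space \<Rightarrow> complex) \<Rightarrow> complex) \<Rightarrow> bool" where
  "positive_definite T \<longleftrightarrow>
     (\<forall>\<phi>\<in>schwartz. T (convolution \<phi> (\<lambda>x. cnj (\<phi> (- x)))) \<in> \<real>\<^sub>\<ge>\<^sub>0)"

end

theory Submission
  imports Defs
begin

text \<open>
  Identify \<open>\<real>\<^sup>4\<close> with \<open>\<complex>\<^sup>2\<close>, and let \<open>f = 1 / (\<parallel>x\<parallel>\<^sub>K\<^sup>2 - |x|\<^sup>2)\<close>, which is another form of the given
  function. It is nonnegative since \<open>K\<close> lies in the unit ball. It is homogeneous of degree \<open>-2\<close> and
  invariant under the simultaneous rotation of both coordinates, that is, under multiplication by
  \<open>e\<^sup>i\<^sup>\<theta>\<close>. Together these two properties say that \<open>f (c x) = |c|\<^sup>-\<^sup>2 f x\<close> for every nonzero complex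
  scalar \<open>c\<close>.

  Almost every point of \<open>\<complex>\<^sup>2\<close> is \<open>(w, w t)\<close> with \<open>w \<noteq> 0\<close>, where \<open>t\<close> names a complex line through the
  origin and \<open>w\<close> a point on it. The change of variables has Jacobian \<open>|w|\<^sup>2\<close>
  (\<open>lborel_line_chart\<close>), which cancels the homogeneity of \<open>f\<close>. Hence
  \<open>\<langle>f, \<Phi>\<rangle> = \<integral> f(1, t) (\<integral> \<Phi>(w, w t) dw) dt\<close>: the distribution \<open>f\<close> is a mixture, with nonnegative
  weights, of integrations over complex lines.

  Integration over a linear subspace \<open>L\<close> is positive definite. Indeed, for \<open>\<Phi> = \<phi> * \<phi>\<^sup>~\<close> with
  \<open>\<phi>\<^sup>~ x\<close> the conjugate of \<open>\<phi> (- x)\<close>, Fubini's theorem turns the integral of \<open>\<Phi>\<close> over \<open>L\<close> into the integral of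
  \<open>|A v|\<^sup>2\<close>, where \<open>A v\<close> is the integral of \<open>\<phi>\<close> over the translate \<open>v + L\<close> and \<open>v\<close> runs over a complement
  (\<open>autocorrelation_integral_nonneg\<close>, \<open>integral_convolution_on_line_nonneg\<close>). So positive
  definiteness needs no Fourier transform.

  For temperedness, compactness places \<open>K\<close> in a ball of radius less than one, so \<open>f x\<close> is at most a
  multiple of \<open>|x|\<^sup>-\<^sup>2\<close> (\<open>minkowski_functional_gt_norm\<close>). Times \<open>(1 + |x|)\<^sup>-\<^sup>4\<close>, such a function is dominated by an
  integrable product of functions of the single coordinates
  (\<open>integrable_radial_weight_norm_power\<close>, \<open>induces_tempered_distribution_of_bound\<close>).
\<close>

section \<open>Linear changes of variables for Lebesgue measure\<close>

text \<open>Such a map is an isometry that only renames coordinates, so it carries boxes to boxes with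
  the same side lengths. It identifies \<open>\<real> \<times> \<real>\<close> with \<open>\<complex>\<close>, and \<open>\<complex> \<times> \<complex>\<close> with \<open>\<real>\<^sup>4\<close>.\<close>

lemma distr_lborel_Basis_bijection:
  fixes T :: "'a::euclidean_space \<Rightarrow> 'b::euclidean_space"
  assumes lin: "linear T" and bij: "bij_betw T Basis Basis"
  shows "distr lborel borel T = lborel"
proof (rule lborel_eqI[symmetric])
  have cont: "continuous_on UNIV T"
    using lin by (simp add: linear_continuous_on linear_linear)
  have [measurable]: "T \<in> borel_measurable borel"
    using cont by (rule borel_measurable_continuous_onI)
  have orth: "T x \<bullet> T i = x \<bullet> i" if i: "i \<in> Basis" for x i
  proof -
    have "T x = (\<Sum>j\<in>Basis. (x \<bullet> j) *\<^sub>R T j)"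
      using lin by (metis (no_types, lifting) euclidean_representation linear_sum linear_scale sum.cong)
    then have "T x \<bullet> T i = (\<Sum>j\<in>Basis. (x \<bullet> j) * (T j \<bullet> T i))"
      by (simp add: inner_sum_left)
    also have "\<dots> = (\<Sum>j\<in>Basis. if j = i then x \<bullet> j else 0)"
    proof (rule sum.cong[OF refl])
      fix j :: 'a assume j: "j \<in> Basis"
      have "T j \<in> Basis" "T i \<in> Basis" "T j = T i \<longleftrightarrow> j = i"
        using bij i j by (auto simp: bij_betw_def inj_on_def)
      then show "(x \<bullet> j) * (T j \<bullet> T i) = (if j = i then x \<bullet> j else 0)"
        by (simp add: inner_Basis)
    qed
    also have "\<dots> = x \<bullet> i"
      using i by simp
    finally show ?thesis .
  qed
  fix l u :: 'b assume le: "\<And>b. b \<in> Basis \<Longrightarrow> l \<bullet> b \<le> u \<bullet> b"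
  define pull where "pull y = (\<Sum>i\<in>Basis. (y \<bullet> T i) *\<^sub>R i)" for y
  have pull: "pull y \<bullet> i = y \<bullet> T i" if "i \<in> Basis" for y i
    using that by (simp add: pull_def inner_sum_left inner_Basis if_distrib cong: if_cong)
  have "T -` box l u = box (pull l) (pull u)"
  proof (rule set_eqI)
    fix x
    have "x \<in> T -` box l u \<longleftrightarrow> (\<forall>i\<in>Basis. l \<bullet> T i < T x \<bullet> T i \<and> T x \<bullet> T i < u \<bullet> T i)"
    proof -
      have "T ` Basis = Basis" using bij by (simp add: bij_betw_def)
      then have "x \<in> T -` box l u \<longleftrightarrow> (\<forall>b\<in>T ` Basis. l \<bullet> b < T x \<bullet> b \<and> T x \<bullet> b < u \<bullet> b)"
        by (simp add: mem_box)
      then show ?thesis by simp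
    qed
    then show "x \<in> T -` box l u \<longleftrightarrow> x \<in> box (pull l) (pull u)"
      by (simp add: mem_box pull orth)
  qed
  then have "emeasure (distr lborel borel T) (box l u) = emeasure lborel (box (pull l) (pull u))"
    by (simp add: emeasure_distr)
  also have "\<dots> = (\<Prod>i\<in>Basis. (pull u - pull l) \<bullet> i)"
  proof (rule emeasure_lborel_box)
    fix i :: 'a assume "i \<in> Basis"
    then show "pull l \<bullet> i \<le> pull u \<bullet> i"
      using le[of "T i"] bij by (auto simp: pull bij_betw_def)
  qed
  also have "(\<Prod>i\<in>Basis. (pull u - pull l) \<bullet> i) = (\<Prod>i\<in>Basis. (u - l) \<bullet> T i)"
    by (intro prod.cong) (auto simp: pull inner_diff_left)
  also have "\<dots> = (\<Prod>b\<in>Basis. (u - l) \<bullet> b)"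
    using bij by (rule prod.reindex_bij_betw)
  finally show "emeasure (distr lborel borel T) (box l u) = (\<Prod>b\<in>Basis. (u - l) \<bullet> b)" .
qed simp

text \<open>Tonelli's theorem for a map that preserves the first coordinate: if each \<open>L u\<close>
  has the constant Jacobian \<open>c u\<close>, then \<open>(u, v) \<mapsto> (u, L u v)\<close> has Jacobian \<open>c u\<close> as well. Both the
  charts adapted to complex lines and the shears below are of this form.\<close>

lemma distr_lborel_fibrewise:
  fixes L :: "'a::euclidean_space \<Rightarrow> 'b::euclidean_space \<Rightarrow> 'b" and c :: "'a \<Rightarrow> real"
  assumes L[measurable]: "(\<lambda>p. L (fst p) (snd p)) \<in> borel_measurable (borel \<Otimes>\<^sub>M borel)"
    and c[measurable]: "c \<in> borel_measurable borel"
    and fibre: "AE u in lborel. \<forall>A\<in>sets borel.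
      emeasure lborel A = ennreal (c u) * emeasure lborel (L u -` A)"
  shows "distr (density lborel (\<lambda>p. ennreal (c (fst p)))) borel (\<lambda>p. (fst p, L (fst p) (snd p)))
    = (lborel :: ('a \<times> 'b) measure)"
proof (rule measure_eqI)
  fix A :: "('a \<times> 'b) set"
  assume "A \<in> sets (distr (density lborel (\<lambda>p. ennreal (c (fst p)))) borel (\<lambda>p. (fst p, L (fst p) (snd p))))"
  then have A: "A \<in> sets borel" by simp
  then have [measurable]: "A \<in> sets (borel \<Otimes>\<^sub>M borel)"
    unfolding borel_prod .
  have [measurable]: "(\<lambda>p. (fst p, L (fst p) (snd p))) \<in> borel_measurable (borel \<Otimes>\<^sub>M borel)"
    by (simp add: borel_prod[symmetric])
  have [measurable]: "L u \<in> borel_measurable borel" for u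
    using measurable_compose[OF measurable_Pair1' L, of u] by simp
  have "emeasure (distr (density lborel (\<lambda>p. ennreal (c (fst p)))) borel (\<lambda>p. (fst p, L (fst p) (snd p)))) A
      = (\<integral>\<^sup>+p. indicator A p \<partial>distr (density (lborel \<Otimes>\<^sub>M lborel) (\<lambda>p. ennreal (c (fst p)))) (borel \<Otimes>\<^sub>M borel)
          (\<lambda>p. (fst p, L (fst p) (snd p))))"
    using A by (simp add: lborel_prod borel_prod)
  also have "\<dots> = (\<integral>\<^sup>+p. ennreal (c (fst p)) * indicator A (fst p, L (fst p) (snd p)) \<partial>(lborel \<Otimes>\<^sub>M lborel))"
    by (simp add: nn_integral_distr nn_integral_density del: nn_integral_indicator)
  also have "\<dots> = (\<integral>\<^sup>+u. \<integral>\<^sup>+v. ennreal (c u) * indicator A (u, L u v) \<partial>lborel \<partial>lborel)"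
    by (subst lborel.nn_integral_fst[symmetric]) simp_all
  also have "\<dots> = (\<integral>\<^sup>+u. emeasure lborel (Pair u -` A) \<partial>lborel)"
  proof (rule nn_integral_cong_AE, rule AE_mp[OF fibre], rule AE_I2, rule impI)
    fix u
    assume *: "\<forall>A\<in>sets borel. emeasure lborel A = ennreal (c u) * emeasure lborel (L u -` A)"
    have S[measurable]: "Pair u -` A \<in> sets borel"
      by measurable
    have "(\<integral>\<^sup>+v. ennreal (c u) * indicator A (u, L u v) \<partial>lborel)
        = (\<integral>\<^sup>+v. ennreal (c u) * indicator (L u -` (Pair u -` A)) v \<partial>lborel)"
      by (intro nn_integral_cong) (simp add: indicator_def)
    also have "\<dots> = ennreal (c u) * emeasure lborel (L u -` (Pair u -` A))"
      using measurable_sets[of "L u" borel borel "Pair u -` A"] S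
      by (intro nn_integral_cmult_indicator) simp
    finally show "(\<integral>\<^sup>+v. ennreal (c u) * indicator A (u, L u v) \<partial>lborel) = emeasure lborel (Pair u -` A)"
      using * S by simp
  qed
  also have "\<dots> = emeasure (lborel \<Otimes>\<^sub>M lborel) A"
    by (subst lborel.emeasure_pair_measure_alt) simp_all
  finally show "emeasure (distr (density lborel (\<lambda>p. ennreal (c (fst p)))) borel (\<lambda>p. (fst p, L (fst p) (snd p)))) A
      = emeasure lborel A"
    by (simp add: lborel_prod)
qed simp

lemma distr_lborel_Complex: "distr (lborel :: (real \<times> real) measure) borel (\<lambda>p. Complex (fst p) (snd p)) = lborel"
proof (rule distr_lborel_Basis_bijection)
  show "linear (\<lambda>p. Complex (fst p) (snd p))"
    by (intro linearI) (auto simp: complex_eq_iff)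
  show "bij_betw (\<lambda>p. Complex (fst p) (snd p)) Basis Basis"
    by (auto simp: bij_betw_def inj_on_def Basis_prod_def Basis_complex_def complex_eq_iff image_iff)
qed

lemma nn_integral_lborel_complex:
  assumes [measurable]: "g \<in> borel_measurable borel"
  shows "(\<integral>\<^sup>+z. g z \<partial>lborel) = (\<integral>\<^sup>+x. \<integral>\<^sup>+y. g (Complex x y) \<partial>lborel \<partial>lborel)"
proof -
  have [measurable]: "(\<lambda>p. Complex (fst p) (snd p)) \<in> borel_measurable (borel \<Otimes>\<^sub>M borel)"
    unfolding Complex_eq by measurable
  have "(\<integral>\<^sup>+z. g z \<partial>lborel) = (\<integral>\<^sup>+p. g (Complex (fst p) (snd p)) \<partial>(lborel \<Otimes>\<^sub>M lborel))"
    by (subst distr_lborel_Complex[symmetric])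
      (simp add: nn_integral_distr lborel_prod[symmetric] borel_prod[symmetric])
  also have "\<dots> = (\<integral>\<^sup>+x. \<integral>\<^sup>+y. g (Complex x y) \<partial>lborel \<partial>lborel)"
    by (subst lborel.nn_integral_fst[symmetric]) simp_all
  finally show ?thesis .
qed

text \<open>Multiplication by \<open>w = a + i b\<close> is the real matrix with rows \<open>(a, -b)\<close> and \<open>(b, a)\<close>. For
  \<open>a \<noteq> 0\<close> it factors into two maps each changing one real coordinate, with Jacobians \<open>a\<close> and
  \<open>(a\<^sup>2 + b\<^sup>2) / a\<close>, so one-dimensional substitution and Tonelli give the factor \<open>a\<^sup>2 + b\<^sup>2\<close>. A purely
  imaginary \<open>w\<close> is a product of two numbers with nonzero real part.\<close>

lemma emeasure_lborel_complex_mult_vimage: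
  fixes w :: complex
  assumes w: "w \<noteq> 0" and A: "A \<in> sets borel"
  shows "emeasure lborel A = ennreal ((norm w)\<^sup>2) * emeasure lborel ((*) w -` A)"
proof -
  have main: "emeasure lborel A = ennreal ((norm w)\<^sup>2) * emeasure lborel ((*) w -` A)"
    if A[measurable]: "A \<in> sets borel" and Re: "Re w \<noteq> 0" for w :: complex and A
  proof -
    define a b where "a = Re w" and "b = Im w"
    define d where "d = (a\<^sup>2 + b\<^sup>2) / a"
    have a: "a \<noteq> 0" using Re by (simp add: a_def)
    have d: "d \<noteq> 0" using a by (simp add: d_def sum_power2_eq_zero_iff)
    define g where "g z = (indicator A z :: ennreal)" for z
    have g[measurable]: "g \<in> borel_measurable borel" unfolding g_def by measurable
    have Cm[measurable]: "(\<lambda>p. Complex (fst p) (snd p)) \<in> borel_measurable (borel \<Otimes>\<^sub>M borel)"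
      unfolding Complex_eq by measurable
    have Cm2[measurable (raw)]: "(\<lambda>x. Complex (p x) (q x)) \<in> borel_measurable M"
      if "p \<in> borel_measurable M" "q \<in> borel_measurable M" for p q and M :: "'x measure"
      using that unfolding Complex_eq by measurable
    have mult: "w * Complex x y = Complex (a * x - b * y) (b * x + a * y)" for x y
      by (simp add: complex_eq_iff a_def b_def)
    \<comment> \<open>the second coordinate, expressed through the already substituted first one\<close>
    have shear: "b * x + a * y = b / a * (a * x - b * y) + d * y" for x y
      using a by (simp add: d_def field_simps power2_eq_square)
    have "(\<integral>\<^sup>+z. g (w * z) \<partial>lborel)
        = (\<integral>\<^sup>+x. \<integral>\<^sup>+y. g (Complex (a * x - b * y) (b / a * (a * x - b * y) + d * y)) \<partial>lborel \<partial>lborel)"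
      by (subst nn_integral_lborel_complex) (simp_all add: mult shear)
    also have "\<dots> = (\<integral>\<^sup>+y. \<integral>\<^sup>+x. g (Complex (a * x - b * y) (b / a * (a * x - b * y) + d * y)) \<partial>lborel \<partial>lborel)"
      by (rule lborel_pair.Fubini'[symmetric]) simp
    finally have "ennreal \<bar>a\<bar> * (\<integral>\<^sup>+z. g (w * z) \<partial>lborel)
        = (\<integral>\<^sup>+y. ennreal \<bar>a\<bar> * (\<integral>\<^sup>+x. g (Complex (a * x - b * y) (b / a * (a * x - b * y) + d * y)) \<partial>lborel) \<partial>lborel)"
      by (simp add: nn_integral_cmult)
    also have "\<dots> = (\<integral>\<^sup>+y. \<integral>\<^sup>+x. g (Complex x (b / a * x + d * y)) \<partial>lborel \<partial>lborel)"
    proof (rule nn_integral_cong)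
      fix y
      show "ennreal \<bar>a\<bar> * (\<integral>\<^sup>+x. g (Complex (a * x - b * y) (b / a * (a * x - b * y) + d * y)) \<partial>lborel)
          = (\<integral>\<^sup>+x. g (Complex x (b / a * x + d * y)) \<partial>lborel)"
        by (subst nn_integral_real_affine[where c=a and t="- b * y"]) (use a in \<open>simp_all add: algebra_simps\<close>)
    qed
    also have "\<dots> = (\<integral>\<^sup>+x. \<integral>\<^sup>+y. g (Complex x (b / a * x + d * y)) \<partial>lborel \<partial>lborel)"
      by (rule lborel_pair.Fubini') simp
    finally have "ennreal \<bar>d\<bar> * (ennreal \<bar>a\<bar> * (\<integral>\<^sup>+z. g (w * z) \<partial>lborel))
        = (\<integral>\<^sup>+x. ennreal \<bar>d\<bar> * (\<integral>\<^sup>+y. g (Complex x (b / a * x + d * y)) \<partial>lborel) \<partial>lborel)"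
      by (simp add: nn_integral_cmult)
    also have "\<dots> = (\<integral>\<^sup>+x. \<integral>\<^sup>+y. g (Complex x y) \<partial>lborel \<partial>lborel)"
    proof (rule nn_integral_cong)
      fix x
      show "ennreal \<bar>d\<bar> * (\<integral>\<^sup>+y. g (Complex x (b / a * x + d * y)) \<partial>lborel)
          = (\<integral>\<^sup>+y. g (Complex x y) \<partial>lborel)"
        by (rule nn_integral_real_affine[where c=d and t="b / a * x", symmetric]) (use d in simp_all)
    qed
    also have "\<dots> = (\<integral>\<^sup>+z. g z \<partial>lborel)"
      by (rule nn_integral_lborel_complex[symmetric]) simp
    also have "\<dots> = emeasure lborel A"
      by (simp add: g_def)
    also have "(\<integral>\<^sup>+z. g (w * z) \<partial>lborel) = (\<integral>\<^sup>+z. indicator ((*) w -` A) z \<partial>lborel)"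
      by (simp add: g_def indicator_def)
    also have "\<dots> = emeasure lborel ((*) w -` A)"
      using measurable_sets[of "(*) w" borel borel A] by (intro nn_integral_indicator) simp
    also have "ennreal \<bar>d\<bar> * (ennreal \<bar>a\<bar> * emeasure lborel ((*) w -` A))
        = ennreal ((norm w)\<^sup>2) * emeasure lborel ((*) w -` A)"
    proof -
      have "\<bar>d\<bar> * \<bar>a\<bar> = (norm w)\<^sup>2"
        using a by (simp add: d_def abs_mult[symmetric] cmod_power2 a_def b_def)
      then show ?thesis
        by (metis abs_ge_zero ennreal_mult mult.assoc)
    qed
    finally show ?thesis by simp
  qed
  show ?thesis
  proof (cases "Re w = 0")
    case False
    then show ?thesis using main A by blast
  next
    case True
    \<comment> \<open>\<open>b (1 + i) \<cdot> (1 + i) / 2 = i b\<close>\<close>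
    define w1 w2 where "w1 = Complex (Im w) (Im w)" and "w2 = Complex (1/2) (1/2)"
    have w12: "w = w1 * w2" "Re w1 \<noteq> 0" "Re w2 \<noteq> 0"
      using True w by (auto simp: w1_def w2_def complex_eq_iff)
    have S: "(*) w1 -` A \<in> sets borel"
      using measurable_sets[of "(*) w1" borel borel A] A by simp
    have "(*) w2 -` ((*) w1 -` A) = (*) w -` A"
      by (auto simp: w12(1) mult.assoc)
    then show ?thesis
      using main[OF A w12(2)] main[OF S w12(3)]
      by (simp add: w12(1) norm_mult power_mult_distrib ennreal_mult mult.assoc)
  qed
qed

section \<open>The Minkowski functional of a compact neighbourhood of the origin\<close>

text \<open>The \<open>LEAST\<close> in the definition is a true minimum: the admissible scalars up to any admissible
  \<open>a0\<close> form the projection of a compact subset of \<open>[0, a0] \<times> K\<close>, and some scalar is admissible because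
  \<open>K\<close> contains a ball around the origin.\<close>

lemma minkowski_functional_attained:
  fixes K :: "'a::euclidean_space set"
  assumes K: "compact K" "0 \<in> interior K"
  shows "0 \<le> minkowski_functional K x"
    and "x \<in> (\<lambda>y. minkowski_functional K x *\<^sub>R y) ` K"
    and "\<And>a. 0 \<le> a \<Longrightarrow> x \<in> (\<lambda>y. a *\<^sub>R y) ` K \<Longrightarrow> minkowski_functional K x \<le> a"
proof -
  define P where "P a \<longleftrightarrow> 0 \<le> a \<and> x \<in> (\<lambda>y. a *\<^sub>R y) ` K" for a
  obtain e where e: "e > 0" "ball 0 e \<subseteq> K"
    using K(2) by (auto simp: mem_interior)
  define a0 where "a0 = 2 * norm x / e"
  have a0: "P a0"
  proof (cases "x = 0")
    case True
    moreover have "0 \<in> K" using e by auto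
    ultimately show ?thesis by (force simp: P_def a0_def)
  next
    case False
    then have "a0 > 0" using e by (simp add: a0_def)
    moreover have "x = a0 *\<^sub>R (inverse a0 *\<^sub>R x)"
      using \<open>a0 > 0\<close> by simp
    moreover have "inverse a0 *\<^sub>R x \<in> K"
    proof -
      have "norm (inverse a0 *\<^sub>R x) = e / 2"
        using False e by (simp add: a0_def)
      then show ?thesis using e by auto
    qed
    ultimately show ?thesis
      unfolding P_def by (metis image_eqI less_imp_le)
  qed
  define S where "S = {0..a0} \<times> K \<inter> {p. fst p *\<^sub>R snd p = x}"
  have "compact S"
    unfolding S_def using K(1)
    by (intro compact_Int_closed compact_Times closed_Collect_eq continuous_intros) auto
  then have cS: "compact (fst ` S)"
    by (intro compact_continuous_image continuous_intros)
  have PS: "a \<in> fst ` S" if "P a" "a \<le> a0" for a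
    using that by (force simp: P_def S_def)
  have SP: "P a" if "a \<in> fst ` S" for a
    using that by (force simp: P_def S_def)
  have "fst ` S \<noteq> {}" using PS[OF a0] by auto
  then obtain m where m: "m \<in> fst ` S" "\<And>a. a \<in> fst ` S \<Longrightarrow> m \<le> a"
    using compact_attains_inf[OF cS] by blast
  have least: "m \<le> a" if "P a" for a
  proof (cases "a \<le> a0")
    case True then show ?thesis using m(2) PS that by blast
  next
    case False then show ?thesis using m(2)[OF PS[OF a0]] by simp
  qed
  have eq: "minkowski_functional K x = m"
    unfolding minkowski_functional_def P_def[symmetric]
    by (rule Least_equality) (use SP[OF m(1)] least in auto)
  show "0 \<le> minkowski_functional K x" "x \<in> (\<lambda>y. minkowski_functional K x *\<^sub>R y) ` K"
    using SP[OF m(1)] by (auto simp: eq P_def)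
  show "minkowski_functional K x \<le> a" if "0 \<le> a" "x \<in> (\<lambda>y. a *\<^sub>R y) ` K" for a
    using least[of a] that by (simp add: P_def eq)
qed

text \<open>The sublevel set at height \<open>a\<close> is the compact image of \<open>[0, a] \<times> K\<close> under scaling; the
  functional is thus lower semicontinuous.\<close>

lemma borel_measurable_minkowski_functional:
  fixes K :: "'a::euclidean_space set"
  assumes K: "compact K" "0 \<in> interior K"
  shows "minkowski_functional K \<in> borel_measurable borel"
  unfolding borel_measurable_iff_le
proof
  fix a :: real
  have "{x. minkowski_functional K x \<le> a} = (\<lambda>p. fst p *\<^sub>R snd p) ` ({0..a} \<times> K)"
  proof (intro set_eqI iffI)
    fix x assume "x \<in> {x. minkowski_functional K x \<le> a}"
    then show "x \<in> (\<lambda>p. fst p *\<^sub>R snd p) ` ({0..a} \<times> K)"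
      using minkowski_functional_attained(1,2)[OF K, of x] by force
  next
    fix x assume "x \<in> (\<lambda>p. fst p *\<^sub>R snd p) ` ({0..a} \<times> K)"
    then obtain b y where "0 \<le> b" "b \<le> a" "y \<in> K" "x = b *\<^sub>R y" by auto
    then show "x \<in> {x. minkowski_functional K x \<le> a}"
      using minkowski_functional_attained(3)[OF K, of b x] by force
  qed
  moreover have "compact ((\<lambda>p. fst p *\<^sub>R snd p) ` ({0..a} \<times> K))"
    using K(1) by (intro compact_continuous_image compact_Times continuous_intros) auto
  ultimately show "{x \<in> space borel. minkowski_functional K x \<le> a} \<in> sets borel"
    by (simp add: borel_compact)
qed

lemma minkowski_functional_scaleR:
  fixes K :: "'a::euclidean_space set"
  assumes K: "compact K" "0 \<in> interior K" and s: "s > 0"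
  shows "minkowski_functional K (s *\<^sub>R x) = s * minkowski_functional K x"
proof -
  have le: "minkowski_functional K (s *\<^sub>R x) \<le> s * minkowski_functional K x" if "s > 0" for s x
  proof (rule minkowski_functional_attained(3)[OF K])
    show "0 \<le> s * minkowski_functional K x"
      using minkowski_functional_attained(1)[OF K] that by simp
    show "s *\<^sub>R x \<in> (\<lambda>y. (s * minkowski_functional K x) *\<^sub>R y) ` K"
      using minkowski_functional_attained(2)[OF K, of x] by (metis (no_types, lifting) image_iff scaleR_scaleR)
  qed
  show ?thesis
    using le[OF s, of x] le[of "inverse s" "s *\<^sub>R x"] s by (simp add: field_simps)
qed

text \<open>By compactness \<open>K\<close> lies in a ball of radius \<open>r < 1\<close>, hence \<open>|x| \<le> r \<parallel>x\<parallel>\<^sub>K\<close>. This uniform gap keeps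
  \<open>\<parallel>x\<parallel>\<^sub>K\<^sup>2 - |x|\<^sup>2\<close> comparable with \<open>|x|\<^sup>2\<close>, so that its inverse has no singularity except at the origin.\<close>

lemma minkowski_functional_gt_norm:
  fixes K :: "'a::euclidean_space set"
  assumes K: "compact K" "0 \<in> interior K" and ball: "K \<subseteq> ball 0 1"
  obtains \<delta> where "\<delta> > 0" "\<And>x. \<delta> * (norm x)\<^sup>2 \<le> (minkowski_functional K x)\<^sup>2 - (norm x)\<^sup>2"
proof -
  have "K \<noteq> {}" using K(2) interior_subset by blast
  then obtain y0 where y0: "y0 \<in> K" "\<And>y. y \<in> K \<Longrightarrow> norm y \<le> norm y0"
    using continuous_attains_sup[OF K(1), of norm] by (auto intro: continuous_intros)
  \<comment> \<open>the maximum with \<open>1 / 2\<close> makes \<open>r\<close> visibly positive\<close>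
  define r where "r = max (norm y0) (1 / 2)"
  have r: "0 < r" "r < 1" using y0 ball by (auto simp: r_def)
  show thesis
  proof
    show "inverse (r\<^sup>2) - 1 > 0"
      using r by (simp add: field_simps power_less_one_iff)
    fix x
    obtain y where y: "y \<in> K" "x = minkowski_functional K x *\<^sub>R y"
      using minkowski_functional_attained(2)[OF K, of x] by auto
    have "norm x = minkowski_functional K x * norm y"
      using arg_cong[OF y(2), of norm] minkowski_functional_attained(1)[OF K, of x] by simp
    also have "\<dots> \<le> minkowski_functional K x * r"
      using minkowski_functional_attained(1)[OF K, of x] y0(2)[OF y(1)]
      by (intro mult_left_mono) (auto simp: r_def)
    finally have "(norm x)\<^sup>2 \<le> (minkowski_functional K x)\<^sup>2 * r\<^sup>2"
      by (metis norm_ge_zero power_mono power_mult_distrib)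
    then show "(inverse (r\<^sup>2) - 1) * (norm x)\<^sup>2 \<le> (minkowski_functional K x)\<^sup>2 - (norm x)\<^sup>2"
      using r by (simp add: field_simps)
  qed
qed

section \<open>Integrable weights and tempered distributions\<close>

text \<open>A one-dimensional weight whose powers control both the singularity at the origin and the decay
  at infinity. At the origin it takes the default value \<open>0\<close>, so comparisons with it hold only away
  from the coordinate hyperplanes, a null set.\<close>

definition radial_weight :: "real \<Rightarrow> real" where
  "radial_weight s = inverse (sqrt \<bar>s\<bar> * (1 + \<bar>s\<bar>))"

lemma radial_weight_nonneg [simp]: "0 \<le> radial_weight s"
  by (simp add: radial_weight_def)

lemma borel_measurable_radial_weight [measurable]: "radial_weight \<in> borel_measurable borel"
  unfolding radial_weight_def by measurable

text \<open>On the positive half-line the weight is the derivative of \<open>2 arctan \<surd>s\<close>, which increases from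
  \<open>0\<close> to \<open>\<pi>\<close>; the weight is even.\<close>

lemma integrable_radial_weight: "integrable lborel radial_weight"
proof -
  have half: "set_integrable lborel {0<..} radial_weight"
  proof -
    have *: "set_integrable lborel (einterval 0 \<infinity>) radial_weight"
    proof (rule interval_integral_FTC_nonneg(1)[where F="\<lambda>s. 2 * arctan (sqrt s)" and A=0 and B="pi"])
      fix x assume x: "0 < ereal x"
      then show "((\<lambda>s. 2 * arctan (sqrt s)) has_real_derivative radial_weight x) (at x)"
        by (auto intro!: derivative_eq_intros simp: radial_weight_def divide_simps)
      show "isCont radial_weight x"
        using x unfolding radial_weight_def by (intro continuous_intros) auto
    next
      have "((\<lambda>s::real. 2 * arctan (sqrt s)) \<longlongrightarrow> 2 * arctan (sqrt 0)) (at_right 0)"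
        by (intro tendsto_intros)
      then show "(((\<lambda>s. 2 * arctan (sqrt s)) \<circ> real_of_ereal) \<longlongrightarrow> 0) (at_right 0)"
        by (simp add: zero_ereal_def ereal_tendsto_simps)
      have "((\<lambda>s::real. 2 * arctan (sqrt s)) \<longlongrightarrow> 2 * (pi / 2)) at_top"
        by (intro tendsto_intros filterlim_compose[OF tendsto_arctan_at_top sqrt_at_top])
      then show "(((\<lambda>s. 2 * arctan (sqrt s)) \<circ> real_of_ereal) \<longlongrightarrow> pi) (at_left \<infinity>)"
        by (simp add: ereal_tendsto_simps)
    qed auto
    have "einterval 0 \<infinity> = {0<..}"
      by (auto simp: einterval_def)
    with * show ?thesis by simp
  qed
  then have pos: "integrable lborel (\<lambda>s. indicator {0<..} s *\<^sub>R radial_weight s)"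
    by (simp add: set_integrable_def)
  then have "integrable lborel (\<lambda>s. indicator {0<..} (0 + - 1 * s) *\<^sub>R radial_weight (0 + - 1 * s))"
    by (rule lborel_integrable_real_affine) simp
  from Bochner_Integration.integrable_add[OF pos this]
  show ?thesis
    by (rule back_subst[of "integrable lborel"])
      (auto simp: radial_weight_def indicator_def fun_eq_iff)
qed

lemma AE_lborel_all_coordinates_nonzero:
  "AE x::'a::euclidean_space in lborel. \<forall>b\<in>Basis. x \<bullet> b \<noteq> 0"
proof (rule AE_finite_allI)
  fix b :: 'a assume b: "b \<in> Basis"
  have "closed {x. b \<bullet> x = 0}" by (rule closed_hyperplane)
  moreover have "{x. b \<bullet> x = 0} \<in> null_sets lebesgue"
    using b by (simp add: negligible_iff_null_sets[symmetric] negligible_hyperplane nonzero_Basis)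
  ultimately have "{x. b \<bullet> x = 0} \<in> null_sets lborel"
    by (simp add: null_sets_completion_iff)
  then show "AE x in lborel. x \<bullet> b \<noteq> 0"
    by (rule AE_I') (auto simp: inner_commute)
qed simp

text \<open>As \<open>|x\<^sub>b| \<le> |x|\<close> for every coordinate and the weight decreases in \<open>|s|\<close>, the function is
  dominated by the product of the one-dimensional weights of the coordinates of \<open>x\<close>. This avoids
  polar coordinates.\<close>

lemma integrable_radial_weight_norm_power:
  "integrable lborel (\<lambda>x::'a::euclidean_space. radial_weight (norm x) ^ DIM('a))"
proof (rule Bochner_Integration.integrable_bound)
  have "(\<integral>\<^sup>+x. (\<Prod>b\<in>Basis. ennreal (radial_weight ((x::'a) \<bullet> b))) \<partial>lborel)
      = (\<Prod>b\<in>(Basis::'a set). \<integral>\<^sup>+s. ennreal (radial_weight s) \<partial>lborel)"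
    by (rule nn_integral_lborel_prod) auto
  also have "\<dots> < \<infinity>"
    using integrable_radial_weight
    by (simp add: integrable_iff_bounded power_less_top_ennreal)
  finally show "integrable lborel (\<lambda>x::'a. \<Prod>b\<in>Basis. radial_weight (x \<bullet> b))"
    by (simp add: integrable_iff_bounded prod_nonneg prod_ennreal)
  show "AE x::'a in lborel. norm (radial_weight (norm x) ^ DIM('a)) \<le> norm (\<Prod>b\<in>Basis. radial_weight (x \<bullet> b))"
  proof (rule AE_mp[OF AE_lborel_all_coordinates_nonzero], rule AE_I2, rule impI)
    fix x :: 'a assume nz: "\<forall>b\<in>Basis. x \<bullet> b \<noteq> 0"
    have "radial_weight (norm x) ^ DIM('a) = (\<Prod>b\<in>(Basis::'a set). radial_weight (norm x))"
      by simp
    also have "\<dots> \<le> (\<Prod>b\<in>Basis. radial_weight (x \<bullet> b))"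
    proof (rule prod_mono)
      fix b :: 'a assume b: "b \<in> Basis"
      then have "\<bar>x \<bullet> b\<bar> \<le> norm x" by (rule Basis_le_norm)
      then have "radial_weight (norm x) \<le> radial_weight (x \<bullet> b)"
        using nz b unfolding radial_weight_def
        by (intro le_imp_inverse_le mult_mono) (auto intro!: mult_pos_pos)
      then show "0 \<le> radial_weight (norm x) \<and> radial_weight (norm x) \<le> radial_weight (x \<bullet> b)" by simp
    qed
    finally show "norm (radial_weight (norm x) ^ DIM('a)) \<le> norm (\<Prod>b\<in>Basis. radial_weight (x \<bullet> b))"
      by (simp add: prod_nonneg)
  qed
qed simp

lemma integrable_inverse_power_norm:
  "integrable lborel (\<lambda>x::'a::euclidean_space. inverse ((1 + norm x) ^ (2 * DIM('a))))"
proof (rule Bochner_Integration.integrable_bound[OF integrable_radial_weight_norm_power])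
  show "AE x::'a in lborel. norm (inverse ((1 + norm x) ^ (2 * DIM('a)))) \<le> norm (radial_weight (norm x) ^ DIM('a))"
    using AE_lborel_singleton[of 0]
  proof (rule AE_mp, intro AE_I2 impI)
    fix x :: 'a assume "x \<noteq> 0"
    moreover have "sqrt (norm x) \<le> 1 + norm x"
    proof -
      have "sqrt (norm x) \<le> sqrt ((1 + norm x)\<^sup>2)"
        by (rule real_sqrt_le_mono) (simp add: power2_sum)
      then show ?thesis by simp
    qed
    ultimately have "inverse ((1 + norm x)\<^sup>2) \<le> radial_weight (norm x)"
      unfolding radial_weight_def power2_eq_square
      by (intro le_imp_inverse_le mult_mono) (auto intro!: mult_pos_pos add_pos_nonneg)
    then have "inverse ((1 + norm x)\<^sup>2) ^ DIM('a) \<le> radial_weight (norm x) ^ DIM('a)"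
      by (intro power_mono) auto
    then show "norm (inverse ((1 + norm x) ^ (2 * DIM('a)))) \<le> norm (radial_weight (norm x) ^ DIM('a))"
      by (simp add: power_mult power_inverse)
  qed
qed simp

lemma schwartz_borel_measurable:
  assumes "\<phi> \<in> schwartz"
  shows "\<phi> \<in> borel_measurable borel"
proof -
  have "\<phi> differentiable (at x)" for x
    using assms unfolding schwartz_def by (auto dest: spec[where x="[]"])
  then have "continuous_on UNIV \<phi>"
    by (simp add: continuous_at_imp_continuous_on differentiable_imp_continuous_within)
  then show ?thesis by (rule borel_measurable_continuous_onI)
qed

text \<open>The supremum defining the seminorm is over finitely many bounded families, hence it is an
  upper bound.\<close>

lemma schwartz_le_schwartz_norm:
  fixes \<phi> :: "'a::euclidean_space \<Rightarrow> complex"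
  assumes "\<phi> \<in> schwartz"
  shows "norm (\<phi> x) \<le> schwartz_norm N \<phi> * inverse ((1 + norm x) ^ N)"
proof -
  define I where "I = {bs::'a list. set bs \<subseteq> Basis \<and> length bs \<le> N}"
  have fin: "finite I" unfolding I_def by (rule finite_lists_length_le) simp
  define q where "q bs x = (1 + norm x) ^ N * norm (iterated_partial bs \<phi> x)" for bs x
  have "bdd_above (range (q bs))" if "bs \<in> I" for bs
  proof -
    have "bounded (range (\<lambda>x. (1 + norm x) ^ N *\<^sub>R iterated_partial bs \<phi> x))"
      using assms that unfolding schwartz_def I_def by blast
    then show ?thesis
      unfolding bounded_iff bdd_above_def q_def by (auto simp: abs_of_nonneg)
  qed
  then have "bdd_above (\<Union>bs\<in>I. range (q bs))"
    using fin by (simp add: bdd_above_UN)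
  also have "(\<Union>bs\<in>I. range (q bs)) = (\<lambda>(bs, x). q bs x) ` (I \<times> UNIV)"
    by auto
  finally have "(\<lambda>(bs, x). q bs x) ([], x) \<le> (SUP (bs, x) \<in> I \<times> UNIV. q bs x)"
    by (intro cSUP_upper) (auto simp: I_def)
  then have "(1 + norm x) ^ N * norm (\<phi> x) \<le> schwartz_norm N \<phi>"
    by (simp add: schwartz_norm_def I_def q_def)
  moreover have "(1 + norm x) ^ N > 0"
    by (simp add: add_pos_nonneg)
  ultimately show ?thesis
    by (simp add: field_simps)
qed

lemma schwartz_norm_nonneg: "0 \<le> schwartz_norm N \<phi>" if "\<phi> \<in> schwartz"
proof -
  have "0 \<le> norm (\<phi> 0)" by simp
  also have "\<dots> \<le> schwartz_norm N \<phi>" using schwartz_le_schwartz_norm[OF that, of 0 N] by simp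
  finally show ?thesis .
qed

lemma schwartz_integrable:
  fixes \<phi> :: "'a::euclidean_space \<Rightarrow> complex"
  assumes "\<phi> \<in> schwartz"
  shows "integrable lborel \<phi>"
proof (rule Bochner_Integration.integrable_bound)
  show "integrable lborel (\<lambda>x::'a. schwartz_norm (2 * DIM('a)) \<phi> * inverse ((1 + norm x) ^ (2 * DIM('a))))"
    by (intro integrable_mult_right integrable_inverse_power_norm)
  show "\<phi> \<in> borel_measurable lborel"
    using schwartz_borel_measurable[OF assms] by simp
  show "AE x in lborel. norm (\<phi> x) \<le> norm (schwartz_norm (2 * DIM('a)) \<phi> * inverse ((1 + norm x) ^ (2 * DIM('a))))"
    using schwartz_le_schwartz_norm[OF assms] by (intro AE_I2) (metis abs_ge_self order_trans real_norm_def)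
qed

text \<open>A singularity of order \<open>n / 2\<close> at the origin of an \<open>n\<close>-dimensional space, with matching decay
  at infinity, is tame enough: together with a factor \<open>(1 + |x|)\<^sup>-\<^sup>n\<close>, which every Schwartz function provides, it
  is dominated by \<open>radial_weight |x| ^ n\<close>.\<close>

lemma induces_tempered_distribution_of_bound:
  fixes f :: "'a::euclidean_space \<Rightarrow> real"
  assumes f[measurable]: "f \<in> borel_measurable borel"
    and bound: "\<And>x. \<bar>f x\<bar> \<le> C * inverse (sqrt (norm x) ^ DIM('a))"
    and C: "C \<ge> 0"
  shows "induces_tempered_distribution f"
proof -
  define n where "n = DIM('a)"
  define W where "W x = radial_weight (norm x) ^ n" for x :: 'a
  have W: "integrable lborel W"
    unfolding W_def n_def by (rule integrable_radial_weight_norm_power)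
  have W0: "0 \<le> W x" for x by (simp add: W_def)
  have weight: "inverse (sqrt (norm x) ^ n) * inverse ((1 + norm x) ^ n) = W x" for x
    by (simp add: W_def radial_weight_def power_mult_distrib power_inverse)
  have fphi: "norm (f x *\<^sub>R \<phi> x) \<le> C * schwartz_norm n \<phi> * W x" if "\<phi> \<in> schwartz" for \<phi> x
  proof -
    have "norm (f x *\<^sub>R \<phi> x) = \<bar>f x\<bar> * norm (\<phi> x)" by simp
    also have "\<dots> \<le> (C * inverse (sqrt (norm x) ^ n)) * (schwartz_norm n \<phi> * inverse ((1 + norm x) ^ n))"
      using bound[of x] C schwartz_le_schwartz_norm[OF that] by (intro mult_mono) (auto simp: n_def)
    also have "\<dots> = C * schwartz_norm n \<phi> * (inverse (sqrt (norm x) ^ n) * inverse ((1 + norm x) ^ n))"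
      by simp
    also have "\<dots> = C * schwartz_norm n \<phi> * W x"
      by (simp only: weight)
    finally show ?thesis .
  qed
  have int: "integrable lborel (\<lambda>x. f x *\<^sub>R \<phi> x)" if phi: "\<phi> \<in> schwartz" for \<phi>
  proof (rule Bochner_Integration.integrable_bound)
    show "integrable lborel (\<lambda>x. C * schwartz_norm n \<phi> * W x)"
      using W by simp
    show "(\<lambda>x. f x *\<^sub>R \<phi> x) \<in> borel_measurable lborel"
      using schwartz_borel_measurable[OF phi] by simp
    show "AE x in lborel. norm (f x *\<^sub>R \<phi> x) \<le> norm (C * schwartz_norm n \<phi> * W x)"
      using fphi[OF phi] by (intro AE_I2) (metis abs_ge_self order_trans real_norm_def)
  qed
  have "locally_integrable f"
    unfolding locally_integrable_def
  proof (intro allI impI)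
    fix S :: "'a set" assume S: "compact S"
    then obtain R where R: "\<And>x. x \<in> S \<Longrightarrow> norm x \<le> R"
      using compact_imp_bounded bounded_iff by metis
    show "set_integrable lborel S f"
      unfolding set_integrable_def
    proof (rule Bochner_Integration.integrable_bound)
      show "integrable lborel (\<lambda>x. C * (1 + \<bar>R\<bar>) ^ n * W x)"
        using W by simp
      show "(\<lambda>x. indicat_real S x *\<^sub>R f x) \<in> borel_measurable lborel"
        using borel_compact[OF S] by measurable
      show "AE x in lborel. norm (indicat_real S x *\<^sub>R f x) \<le> norm (C * (1 + \<bar>R\<bar>) ^ n * W x)"
      proof (rule AE_I2)
        fix x
        show "norm (indicat_real S x *\<^sub>R f x) \<le> norm (C * (1 + \<bar>R\<bar>) ^ n * W x)"
        proof (cases "x \<in> S")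
          case True
          have "\<bar>f x\<bar> \<le> C * inverse (sqrt (norm x) ^ n)"
            using bound by (simp add: n_def)
          also have "\<dots> = C * (1 + norm x) ^ n * W x"
            proof -
            have "1 + norm x > 0" by (simp add: add_pos_nonneg)
            then show ?thesis unfolding weight[symmetric] by simp
          qed
          also have "\<dots> \<le> C * (1 + \<bar>R\<bar>) ^ n * W x"
            using R[OF True] C W0 by (intro mult_right_mono mult_left_mono power_mono) auto
          finally show ?thesis using True by simp
        qed simp
      qed
    qed
  qed
  moreover have "tempered_distribution (distribution_of f)"
    unfolding tempered_distribution_def
  proof (intro conjI ballI allI)
    fix \<phi> \<psi> :: "'a \<Rightarrow> complex" assume "\<phi> \<in> schwartz" "\<psi> \<in> schwartz"
    then show "distribution_of f (\<lambda>x. \<phi> x + \<psi> x) = distribution_of f \<phi> + distribution_of f \<psi>"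
      using int by (simp add: distribution_of_def scaleR_add_right)
  next
    fix c and \<phi> :: "'a \<Rightarrow> complex"
    have "(\<lambda>x. f x *\<^sub>R (c * \<phi> x)) = (\<lambda>x. c * (f x *\<^sub>R \<phi> x))" by simp
    then show "distribution_of f (\<lambda>x. c * \<phi> x) = c * distribution_of f \<phi>"
      unfolding distribution_of_def by (simp only: integral_mult_right_zero)
  next
    have "norm (distribution_of f \<phi>) \<le> C * (LINT x|lborel. W x) * schwartz_norm n \<phi>"
      if phi: "\<phi> \<in> schwartz" for \<phi>
    proof -
      have "norm (distribution_of f \<phi>) \<le> (LINT x|lborel. C * schwartz_norm n \<phi> * W x)"
        unfolding distribution_of_def
        using W int[OF phi] fphi[OF phi] by (intro Bochner_Integration.integral_norm_bound_integral) auto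
      then show ?thesis by (simp add: mult.commute mult.left_commute)
    qed
    then show "\<exists>N C. \<forall>\<phi>\<in>schwartz. norm (distribution_of f \<phi>) \<le> C * schwartz_norm N \<phi>"
      by blast
  qed
  ultimately show ?thesis
    using int by (simp add: induces_tempered_distribution_def)
qed

section \<open>Autocorrelations integrated along a subspace\<close>

lemma borel_measurable_cnj [measurable (raw)]:
  assumes "f \<in> borel_measurable M"
  shows "(\<lambda>x. cnj (f x)) \<in> borel_measurable M"
  by (rule borel_measurable_continuous_on[OF _ assms]) (intro continuous_intros)

lemma distr_lborel_minus_left: "distr lborel borel (\<lambda>w. u - w) = (lborel :: 'a::euclidean_space measure)"
proof -
  have "lborel = density (distr lborel borel (\<lambda>w::'a. u + (- 1) *\<^sub>R w)) (\<lambda>_. ennreal (\<bar>- 1\<bar> ^ DIM('a)))"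
    by (rule lborel_affine) simp
  then show ?thesis by (simp add: density_1)
qed

text \<open>This is the source of positivity. Write \<open>A v\<close> for the integral of \<open>\<psi>\<close> over the slice at
  height \<open>v\<close>. By Fubini's theorem and translation invariance the integral equals
  \<open>\<integral> |A v|\<^sup>2 dv\<close>. The uniform bound on the slices makes the double integral absolutely convergent.\<close>

lemma autocorrelation_integral_nonneg:
  fixes \<psi> :: "'a::euclidean_space \<times> 'b::euclidean_space \<Rightarrow> complex"
  assumes int: "integrable lborel \<psi>"
    and slice: "\<And>v. integrable lborel (\<lambda>u. \<psi> (u, v))"
    and bound: "\<And>v. (LINT u|lborel. norm (\<psi> (u, v))) \<le> M"
  shows "(LINT w|lborel. LINT p|lborel. \<psi> p * cnj (\<psi> (fst p - w, snd p))) \<in> \<real>\<^sub>\<ge>\<^sub>0"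
proof -
  define k where "k p w = \<psi> p * cnj (\<psi> (fst p - w, snd p))" for p w
  define A where "A v = (LINT u|lborel. \<psi> (u, v))" for v
  define N where "N v = (LINT u|lborel. norm (\<psi> (u, v)))" for v
  have \<psi>b[measurable]: "\<psi> \<in> borel_measurable (borel \<Otimes>\<^sub>M borel)"
    using borel_measurable_integrable[OF int] by (simp add: borel_prod)
  have sl: "(\<lambda>u. \<psi> (u, v)) \<in> borel_measurable borel" for v
    by measurable
  have Am[measurable]: "A \<in> borel_measurable borel" and Nm[measurable]: "N \<in> borel_measurable borel"
    unfolding A_def N_def by measurable
  have N0: "0 \<le> N v" for v by (simp add: N_def)
  have AN: "norm (A v) \<le> N v" for v
    unfolding A_def N_def by (rule integral_norm_bound)
  have transl_int: "integrable lborel (\<lambda>w. \<psi> (u - w, v))" for u v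
  proof -
    have "integrable (distr lborel borel (\<lambda>w. u - w)) (\<lambda>u. \<psi> (u, v))"
      using slice by (simp add: distr_lborel_minus_left)
    then show ?thesis using sl by (subst (asm) integrable_distr_eq) simp_all
  qed
  have transl: "(LINT w|lborel. g (u - w)) = (LINT u|lborel. g u)"
    if "g \<in> borel_measurable borel" for u and g :: "'a \<Rightarrow> 'c::{banach, second_countable_topology}"
    using integral_distr[of "\<lambda>w. u - w" lborel borel g] that by (simp add: distr_lborel_minus_left)
  \<comment> \<open>covers \<open>c = N\<close>, which justifies Fubini's theorem, and \<open>c = cnj \<circ> A\<close>, which splits the last integral into slices\<close>
  have dominated: "integrable lborel (\<lambda>p. \<psi> p * c (snd p))"
    if [measurable]: "c \<in> borel_measurable borel" and c: "\<And>v. norm (c v) \<le> N v" for c :: "'b \<Rightarrow> complex"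
  proof (rule Bochner_Integration.integrable_bound)
    show "integrable lborel (\<lambda>p. complex_of_real M * \<psi> p)"
      using int by simp
    have "(\<lambda>p. \<psi> p * c (snd p)) \<in> borel_measurable (borel \<Otimes>\<^sub>M borel)"
      by measurable
    then show "(\<lambda>p. \<psi> p * c (snd p)) \<in> borel_measurable lborel"
      by (simp add: borel_prod)
    have "norm (c v) \<le> \<bar>M\<bar>" for v
      using c[of v] bound[of v] by (simp add: N_def)
    then show "AE p in lborel. norm (\<psi> p * c (snd p)) \<le> norm (complex_of_real M * \<psi> p)"
      by (intro AE_I2) (simp add: norm_mult mult.commute[of "\<bar>M\<bar>"] mult_left_mono)
  qed
  have "integrable (lborel \<Otimes>\<^sub>M lborel) (case_prod k)"
  proof (rule lborel_pair.Fubini_integrable)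
    have "(\<lambda>q. \<psi> (fst (fst q) - snd q, snd (fst q))) \<in> borel_measurable ((borel \<Otimes>\<^sub>M borel) \<Otimes>\<^sub>M borel)"
      by (rule measurable_compose[OF _ \<psi>b]) measurable
    then have "case_prod k \<in> borel_measurable ((borel \<Otimes>\<^sub>M borel) \<Otimes>\<^sub>M borel)"
      unfolding k_def by measurable
    then show "case_prod k \<in> borel_measurable (lborel \<Otimes>\<^sub>M lborel)"
      unfolding borel_prod lborel_prod by simp
    have "(LINT w|lborel. norm (k p w)) = norm (\<psi> p) * N (snd p)" for p
    proof -
      have "(LINT w|lborel. norm (k p w)) = norm (\<psi> p) * (LINT w|lborel. norm (\<psi> (fst p - w, snd p)))"
        by (simp add: k_def norm_mult)
      also have "(LINT w|lborel. norm (\<psi> (fst p - w, snd p))) = N (snd p)"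
        unfolding N_def using sl by (intro transl) simp
      finally show ?thesis .
    qed
    moreover have "integrable lborel (\<lambda>p. norm (\<psi> p * complex_of_real (N (snd p))))"
      using N0 by (intro integrable_norm dominated) simp_all
    ultimately show "integrable lborel (\<lambda>p. LINT w|lborel. norm (case (p, w) of (p, w) \<Rightarrow> k p w))"
      using N0 by (simp add: norm_mult)
    show "AE p in lborel. integrable lborel (\<lambda>w. case (p, w) of (p, w) \<Rightarrow> k p w)"
      using transl_int by (simp add: k_def)
  qed
  then have "(LINT w|lborel. LINT p|lborel. k p w) = (LINT p|lborel. LINT w|lborel. k p w)"
    by (rule lborel_pair.Fubini_integral)
  also have "\<dots> = (LINT p|lborel. \<psi> p * cnj (A (snd p)))"
  proof (rule Bochner_Integration.integral_cong[OF refl])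
    fix p :: "'a \<times> 'b"
    have "(LINT w|lborel. k p w) = \<psi> p * cnj (LINT w|lborel. \<psi> (fst p - w, snd p))"
      by (simp add: k_def)
    also have "(LINT w|lborel. \<psi> (fst p - w, snd p)) = A (snd p)"
      unfolding A_def using sl by (intro transl) simp
    finally show "(LINT w|lborel. k p w) = \<psi> p * cnj (A (snd p))" .
  qed
  also have "\<dots> = (LINT v|lborel. LINT u|lborel. \<psi> (u, v) * cnj (A v))"
  proof -
    have "integrable lborel (\<lambda>p. \<psi> p * cnj (A (snd p)))"
      using AN by (intro dominated) simp_all
    then have "integrable (lborel \<Otimes>\<^sub>M lborel) (\<lambda>(u, v). \<psi> (u, v) * cnj (A v))"
      by (simp add: lborel_prod case_prod_unfold)
    then show ?thesis
      by (subst lborel_pair.integral_snd) (simp_all add: lborel_prod case_prod_unfold)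
  qed
  also have "\<dots> = (LINT v|lborel. complex_of_real ((norm (A v))\<^sup>2))"
    by (simp add: A_def[symmetric] complex_mult_cnj cmod_power2)
  also have "\<dots> = complex_of_real (LINT v|lborel. (norm (A v))\<^sup>2)"
    by (rule integral_complex_of_real)
  also have "\<dots> \<in> \<real>\<^sub>\<ge>\<^sub>0"
    by (simp add: nonneg_Reals_of_real_iff)
  finally show ?thesis by (simp add: k_def)
qed

section \<open>Complex coordinates and complex lines in four-dimensional space\<close>

definition realify :: "complex \<times> complex \<Rightarrow> real ^ 4" where
  "realify p = vector [Re (fst p), Im (fst p), Re (snd p), Im (snd p)]"

lemma realify_nth:
  "realify p $ 1 = Re (fst p)" "realify p $ 2 = Im (fst p)"
  "realify p $ 3 = Re (snd p)" "realify p $ 4 = Im (snd p)"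
  by (simp_all add: realify_def vector_def)

lemma linear_realify: "linear realify"
  by (intro linearI) (simp_all add: vec_eq_iff forall_4 realify_nth)

lemma borel_measurable_realify [measurable]: "realify \<in> borel_measurable borel"
  by (intro borel_measurable_continuous_onI linear_continuous_on) (simp add: linear_realify linear_conv_bounded_linear[symmetric])

lemma distr_lborel_realify: "distr lborel borel realify = lborel"
proof (rule distr_lborel_Basis_bijection[OF linear_realify])
  have "realify ` Basis = {axis 1 1, axis 2 1, axis 3 1, axis 4 1}"
    by (simp add: Basis_prod_def Basis_complex_def image_Un insert_commute vec_eq_iff forall_4 realify_nth axis_def
        set_eq_iff) blast
  also have "\<dots> = Basis"
    by (auto simp: Basis_vec_def UNIV_4)
  finally have "realify ` Basis = Basis" .
  moreover have "inj_on realify Basis"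
    by (intro inj_onI) (simp add: vec_eq_iff forall_4 realify_nth prod_eq_iff complex_eq_iff)
  ultimately show "bij_betw realify Basis Basis"
    by (simp add: bij_betw_def)
qed

lemma norm_realify: "norm (realify p) = norm p"
  by (simp add: norm_vec_def L2_set_def sum_4 realify_nth norm_prod_def cmod_def)

lemma rot4_realify:
  "rot4 \<theta> (realify (z, w)) = realify (cis \<theta> * z, cis \<theta> * w)"
  by (simp add: vec_eq_iff forall_4 rot4_nth realify_nth)

lemma integral_complex_nonneg_Reals:
  fixes f :: "'a \<Rightarrow> complex"
  assumes "\<And>t. f t \<in> \<real>\<^sub>\<ge>\<^sub>0"
  shows "(LINT t|M. f t) \<in> \<real>\<^sub>\<ge>\<^sub>0"
proof -
  have "f t = complex_of_real (Re (f t))" "0 \<le> Re (f t)" for t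
    using assms[of t] by (auto simp: complex_nonneg_Reals_iff complex_eq_iff)
  then have "(LINT t|M. f t) = complex_of_real (LINT t|M. Re (f t))"
    by (metis (no_types, lifting) Bochner_Integration.integral_cong integral_complex_of_real)
  then show ?thesis
    using \<open>\<And>t. 0 \<le> Re (f t)\<close> by (simp add: nonneg_Reals_of_real_iff)
qed

text \<open>The pair \<open>(w, t)\<close> describes the point \<open>(w, w t)\<close> of the complex line with slope \<open>t\<close>. The
  Jacobian \<open>|w|\<^sup>2\<close> is exactly what cancels a homogeneity of degree \<open>-2\<close>.\<close>

lemma lborel_line_chart:
  "distr (density lborel (\<lambda>p. ennreal ((norm (fst p))\<^sup>2))) borel (\<lambda>p. (fst p, fst p * snd p))
    = (lborel :: (complex \<times> complex) measure)"
proof (rule distr_lborel_fibrewise)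
  show "AE w::complex in lborel. \<forall>A\<in>sets borel.
      emeasure lborel A = ennreal ((norm w)\<^sup>2) * emeasure lborel ((*) w -` A)"
    by (rule AE_mp[OF AE_lborel_singleton[of 0]], intro AE_I2 impI ballI)
      (rule emeasure_lborel_complex_mult_vimage)
qed measurable

lemma distr_lborel_shear:
  "distr lborel borel (\<lambda>p. (fst p, snd p + fst p * t)) = (lborel :: (complex \<times> complex) measure)"
proof -
  have "distr (density lborel (\<lambda>p. ennreal ((\<lambda>_. 1) (fst p)))) borel (\<lambda>p. (fst p, (\<lambda>u v. v + u * t) (fst p) (snd p)))
      = (lborel :: (complex \<times> complex) measure)"
  proof (rule distr_lborel_fibrewise)
    have "emeasure lborel A = emeasure lborel ((\<lambda>v. v + u * t) -` A)" if "A \<in> sets borel" for A and u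
    proof -
      have "emeasure lborel A = emeasure (distr lborel borel ((+) (u * t))) A"
        by (simp add: lborel_distr_plus)
      also have "\<dots> = emeasure lborel ((+) (u * t) -` A)"
        using that by (subst emeasure_distr) simp_all
      also have "(+) (u * t) -` A = (\<lambda>v. v + u * t) -` A"
        by (auto simp: add.commute)
      finally show ?thesis .
    qed
    then show "AE u in lborel. \<forall>A\<in>sets borel.
        emeasure lborel A = ennreal 1 * emeasure lborel ((\<lambda>v. v + u * t) -` A)"
      by simp
  qed measurable
  then show ?thesis by (simp add: density_1)
qed

lemma borel_measurable_convolution:
  assumes "\<phi> \<in> borel_measurable borel" "\<psi> \<in> borel_measurable borel"
  shows "convolution \<phi> \<psi> \<in> borel_measurable borel"
  using assms unfolding convolution_def[abs_def] by measurable

text \<open>The shear \<open>(u, v) \<mapsto> (u, v + u t)\<close> preserves volume and turns the line of slope \<open>t\<close> into the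
  first coordinate axis, where the integral of \<open>\<phi> * \<phi>\<^sup>~\<close> becomes an integrated autocorrelation.\<close>

lemma integral_convolution_on_line_nonneg:
  fixes \<phi> :: "real ^ 4 \<Rightarrow> complex"
  assumes phi: "\<phi> \<in> schwartz"
  shows "(LINT w|lborel. convolution \<phi> (\<lambda>x. cnj (\<phi> (- x))) (realify (w, w * t))) \<in> \<real>\<^sub>\<ge>\<^sub>0"
proof -
  define S where "S p = realify (fst p, snd p + fst p * t)" for p
  define \<psi> where "\<psi> p = \<phi> (S p)" for p
  have [measurable]: "\<phi> \<in> borel_measurable borel"
    using phi by (rule schwartz_borel_measurable)
  have shear_m: "(\<lambda>p::complex \<times> complex. (fst p, snd p + fst p * t)) \<in> borel_measurable borel"
    by (intro borel_measurable_continuous_onI continuous_intros)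
  have Sm[measurable]: "S \<in> borel_measurable borel"
    unfolding S_def using measurable_compose[OF shear_m borel_measurable_realify] by simp
  have S: "distr lborel borel S = lborel"
  proof -
    have "distr lborel borel S = distr (distr lborel borel (\<lambda>p. (fst p, snd p + fst p * t))) borel realify"
      using shear_m by (subst distr_distr) (simp_all add: S_def[abs_def] comp_def)
    then show ?thesis by (simp add: distr_lborel_shear distr_lborel_realify)
  qed
  have diff: "S p - realify (w, w * t) = S (fst p - w, snd p)" for p w
    by (simp add: S_def linear_diff[OF linear_realify, symmetric] algebra_simps)
  have conv: "convolution \<phi> (\<lambda>x. cnj (\<phi> (- x))) (realify (w, w * t))
      = (LINT p|lborel. \<psi> p * cnj (\<psi> (fst p - w, snd p)))" for w
  proof -
    have "convolution \<phi> (\<lambda>x. cnj (\<phi> (- x))) (realify (w, w * t))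
        = (LINT y|distr lborel borel S. \<phi> y * cnj (\<phi> (y - realify (w, w * t))))"
      by (simp add: convolution_def S)
    also have "\<dots> = (LINT p|lborel. \<phi> (S p) * cnj (\<phi> (S p - realify (w, w * t))))"
      by (rule integral_distr) simp_all
    finally show ?thesis by (simp add: diff \<psi>_def)
  qed
  define B where "B = schwartz_norm 4 \<phi>"
  have B: "0 \<le> B" unfolding B_def using phi by (rule schwartz_norm_nonneg)
  have dec: "norm (\<psi> (u, v)) \<le> B * inverse ((1 + norm u) ^ 4)" for u v
  proof -
    have "norm u \<le> norm (S (u, v))"
      by (simp add: S_def norm_realify norm_fst_le[of u, simplified])
    then have "inverse ((1 + norm (S (u, v))) ^ 4) \<le> inverse ((1 + norm u) ^ 4)"
      using add_pos_nonneg[OF zero_less_one norm_ge_zero[of u]]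
      by (intro le_imp_inverse_le power_mono zero_less_power) auto
    then show ?thesis
      using schwartz_le_schwartz_norm[OF phi, of "S (u, v)" 4] B
      unfolding \<psi>_def B_def by (meson mult_left_mono order_trans)
  qed
  have int_dec: "integrable lborel (\<lambda>u::complex. B * inverse ((1 + norm u) ^ 4))"
    using integrable_inverse_power_norm[where 'a=complex] by simp
  have \<psi>m: "(\<lambda>u. \<psi> (u, v)) \<in> borel_measurable borel" for v
  proof -
    have "(\<lambda>u::complex. (u, v)) \<in> borel_measurable borel"
      by (intro borel_measurable_continuous_onI continuous_intros)
    then have "(\<lambda>u. S (u, v)) \<in> borel_measurable borel"
      using Sm by (rule measurable_compose)
    then show ?thesis unfolding \<psi>_def by measurable
  qed
  have slice: "integrable lborel (\<lambda>u. \<psi> (u, v))" for v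
  proof (rule Bochner_Integration.integrable_bound[OF int_dec])
    show "AE u in lborel. norm (\<psi> (u, v)) \<le> norm (B * inverse ((1 + norm u) ^ 4))"
      using dec by (intro AE_I2) (metis abs_ge_self order_trans real_norm_def)
  qed (use \<psi>m in simp)
  have "integrable lborel \<psi>"
  proof -
    have "integrable (distr lborel borel S) \<phi>"
      using schwartz_integrable[OF phi] by (simp add: S)
    then show ?thesis
      unfolding \<psi>_def by (subst (asm) integrable_distr_eq) simp_all
  qed
  moreover have "(LINT u|lborel. norm (\<psi> (u, v))) \<le> (LINT u|lborel. B * inverse ((1 + norm (u::complex)) ^ 4))" for v
    by (intro integral_mono integrable_norm slice int_dec dec)
  ultimately show ?thesis
    unfolding conv using slice by (intro autocorrelation_integral_nonneg)
qed

section \<open>Positive definiteness\<close>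

text \<open>In the coordinates \<open>(w, t)\<close> the function \<open>|w|\<^sup>2 f\<close> depends on \<open>t\<close> alone. Pairing \<open>f\<close> with
  \<open>\<Phi> = \<phi> * \<phi>\<^sup>~\<close> therefore gives \<open>\<integral> f(1, t) (\<integral> \<Phi>(w, w t) dw) dt\<close>, a superposition with weights
  \<open>f(1, t) \<ge> 0\<close> of integrals of \<open>\<Phi>\<close> over complex lines, each of which is nonnegative. If \<open>f \<Phi>\<close> fails
  to be integrable, the pairing has the default value \<open>0\<close>; for a function that induces a tempered
  distribution and a Schwartz function \<open>\<Phi>\<close> this case does not arise.\<close>

lemma positive_definite_distribution_of_complex_homogeneous:
  fixes f :: "real ^ 4 \<Rightarrow> real"
  assumes nonneg: "\<And>x. 0 \<le> f x"
    and homogeneous: "\<And>c z w. c \<noteq> 0 \<Longrightarrow> (norm c)\<^sup>2 * f (realify (c * z, c * w)) = f (realify (z, w))"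
  shows "positive_definite (distribution_of f)"
  unfolding positive_definite_def
proof
  fix \<phi> :: "real ^ 4 \<Rightarrow> complex" assume phi: "\<phi> \<in> schwartz"
  define \<Phi> where "\<Phi> = convolution \<phi> (\<lambda>x. cnj (\<phi> (- x)))"
  define F where "F x = f x *\<^sub>R \<Phi> x" for x
  show "distribution_of f (convolution \<phi> (\<lambda>x. cnj (\<phi> (- x)))) \<in> \<real>\<^sub>\<ge>\<^sub>0"
  proof (cases "integrable lborel F")
    case False
    then have "distribution_of f \<Phi> = 0"
      unfolding distribution_of_def F_def by (rule not_integrable_integral_eq)
    then show ?thesis by (simp add: \<Phi>_def)
  next
    case True
    define chart :: "complex \<times> complex \<Rightarrow> complex \<times> complex" where "chart p = (fst p, fst p * snd p)" for p
    define H where "H w t = (norm w)\<^sup>2 *\<^sub>R F (realify (w, w * t))" for w t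
    have Fm: "F \<in> borel_measurable borel"
      using borel_measurable_integrable[OF True] by simp
    have \<Phi>m: "\<Phi> \<in> borel_measurable borel"
    proof -
      have [measurable]: "\<phi> \<in> borel_measurable borel"
        using phi by (rule schwartz_borel_measurable)
      show ?thesis
        unfolding \<Phi>_def by (intro borel_measurable_convolution) measurable
    qed
    have cm: "chart \<in> borel_measurable borel"
      unfolding chart_def by (intro borel_measurable_continuous_onI continuous_intros)
    have jac: "(\<lambda>p::complex \<times> complex. (norm (fst p))\<^sup>2) \<in> borel_measurable lborel"
      by (simp, intro borel_measurable_continuous_onI continuous_intros)
    have Frm: "(\<lambda>p. F (realify p)) \<in> borel_measurable borel"
      using Fm by measurable
    have Frcm: "(\<lambda>p. F (realify (chart p))) \<in> borel_measurable borel"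
      using measurable_compose[OF cm Frm] .
    have chart: "distr (density lborel (\<lambda>p. ennreal ((norm (fst p))\<^sup>2))) borel chart = lborel"
      using lborel_line_chart by (simp add: chart_def[abs_def])
    have HF: "(\<lambda>p. (norm (fst p))\<^sup>2 *\<^sub>R F (realify (chart p))) = (\<lambda>(w, t). H w t)"
      by (simp add: H_def chart_def fun_eq_iff)
    have "integrable (distr lborel borel realify) F"
      using True by (simp add: distr_lborel_realify)
    then have "integrable lborel (\<lambda>p. F (realify p))"
      using Fm by (subst (asm) integrable_distr_eq) simp_all
    then have "integrable (distr (density lborel (\<lambda>p. ennreal ((norm (fst p))\<^sup>2))) borel chart) (\<lambda>p. F (realify p))"
      by (simp add: chart)
    then have "integrable (density lborel (\<lambda>p. ennreal ((norm (fst p))\<^sup>2))) (\<lambda>p. F (realify (chart p)))"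
      using cm Frm by (subst (asm) integrable_distr_eq) simp_all
    then have "integrable lborel (\<lambda>p. (norm (fst p))\<^sup>2 *\<^sub>R F (realify (chart p)))"
      using Frcm jac by (subst (asm) integrable_density) simp_all
    then have int: "integrable (lborel \<Otimes>\<^sub>M lborel) (\<lambda>(w, t). H w t)"
      unfolding HF by (simp add: lborel_prod)
    have "distribution_of f \<Phi> = (LINT x|distr lborel borel realify. F x)"
      by (simp add: distribution_of_def F_def distr_lborel_realify)
    also have "\<dots> = (LINT p|lborel. F (realify p))"
      using Fm by (intro integral_distr) simp_all
    also have "\<dots> = (LINT p|distr (density lborel (\<lambda>p. ennreal ((norm (fst p))\<^sup>2))) borel chart. F (realify p))"
      by (simp add: chart)
    also have "\<dots> = (LINT p|density lborel (\<lambda>p. ennreal ((norm (fst p))\<^sup>2)). F (realify (chart p)))"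
      using cm Frm by (intro integral_distr) simp_all
    also have "\<dots> = (LINT p|lborel. (norm (fst p))\<^sup>2 *\<^sub>R F (realify (chart p)))"
      using Frcm jac by (intro integral_density) simp_all
    also have "\<dots> = (LINT p|(lborel \<Otimes>\<^sub>M lborel). (\<lambda>(w, t). H w t) p)"
      unfolding HF by (simp add: lborel_prod)
    also have "\<dots> = (LINT t|lborel. LINT w|lborel. H w t)"
      using int by (subst lborel_pair.integral_snd) simp_all
    also have "\<dots> \<in> \<real>\<^sub>\<ge>\<^sub>0"
    proof (rule integral_complex_nonneg_Reals)
      fix t
      have "AE w::complex in lborel. w \<noteq> 0"
        by (rule AE_lborel_singleton)
      then have ae: "AE w in lborel. f (realify (1, t)) *\<^sub>R \<Phi> (realify (w, w * t)) = H w t"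
      proof (rule AE_mp, intro AE_I2 impI)
        fix w :: complex assume "w \<noteq> 0"
        then show "f (realify (1, t)) *\<^sub>R \<Phi> (realify (w, w * t)) = H w t"
          using homogeneous[of w 1 t] by (simp add: H_def F_def)
      qed
      have "(LINT w|lborel. H w t) = f (realify (1, t)) *\<^sub>R (LINT w|lborel. \<Phi> (realify (w, w * t)))"
      proof -
        have "(\<lambda>w. H w t) \<in> borel_measurable lborel"
        proof -
          have "(\<lambda>w::complex. (w, t)) \<in> borel_measurable borel"
            by (intro borel_measurable_continuous_onI continuous_intros)
          from measurable_compose[OF this Frcm] show ?thesis
            unfolding H_def by (simp add: chart_def)
        qed
        moreover have "(\<lambda>w. \<Phi> (realify (w, w * t))) \<in> borel_measurable borel"
        proof -
          have "(\<lambda>w::complex. (w, w * t)) \<in> borel_measurable borel"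
            by (intro borel_measurable_continuous_onI continuous_intros)
          then have "(\<lambda>w. realify (w, w * t)) \<in> borel_measurable borel"
            by measurable
          from measurable_compose[OF this \<Phi>m] show ?thesis .
        qed
        ultimately have "(LINT w|lborel. H w t) = (LINT w|lborel. f (realify (1, t)) *\<^sub>R \<Phi> (realify (w, w * t)))"
          using ae by (intro integral_cong_AE) (auto elim: AE_mp)
        then show ?thesis by simp
      qed
      also have "\<dots> \<in> \<real>\<^sub>\<ge>\<^sub>0"
        using integral_convolution_on_line_nonneg[OF phi, of t] nonneg
        by (simp add: \<Phi>_def scaleR_conv_of_real nonneg_Reals_mult_I)
      finally show "(LINT w|lborel. H w t) \<in> \<real>\<^sub>\<ge>\<^sub>0" .
    qed
    finally show ?thesis by (simp add: \<Phi>_def)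
  qed
qed

theorem lemma8:
  fixes K :: "(real ^ 4) set" and f :: "real ^ 4 \<Rightarrow> real"
  assumes "star_body K"
    and "rotation_invariant K"
    and "K \<subseteq> ball 0 1"
  defines "f \<equiv> \<lambda>x. minkowski_functional K x powi (-2) /
                  (1 - (norm x / minkowski_functional K x)\<^sup>2)"
  shows "induces_tempered_distribution f \<and> positive_definite (distribution_of f)"
proof -
  define \<mu> where "\<mu> = minkowski_functional K"
  have K: "compact K" "0 \<in> interior K"
    using assms(1) by (auto simp: star_body_def)
  obtain \<delta> where \<delta>: "\<delta> > 0" "\<And>x. \<delta> * (norm x)\<^sup>2 \<le> (\<mu> x)\<^sup>2 - (norm x)\<^sup>2"
    using minkowski_functional_gt_norm[OF K assms(3)] unfolding \<mu>_def by blast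
  \<comment> \<open>the formula includes \<open>x = 0\<close>, where both sides have the default value \<open>0\<close>\<close>
  have f: "f x = inverse ((\<mu> x)\<^sup>2 - (norm x)\<^sup>2)" for x
  proof (cases "\<mu> x = 0")
    case True
    then have "norm x = 0"
      using \<delta>(1) \<delta>(2)[of x] by (smt (verit) mult_nonneg_nonneg power2_less_0 zero_le_power2 mult_pos_pos power_zero_numeral zero_less_power2)
    then show ?thesis using True by (simp add: f_def \<mu>_def)
  next
    case False
    then show ?thesis
      by (simp add: f_def \<mu>_def[symmetric] power_int_minus field_simps)
  qed
  have nonneg: "0 \<le> f x" for x
  proof -
    have "0 \<le> \<delta> * (norm x)\<^sup>2" using \<delta>(1) by simp
    then show ?thesis using \<delta>(2)[of x] by (simp add: f)
  qed
  have "induces_tempered_distribution f"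
  proof (rule induces_tempered_distribution_of_bound)
    have [measurable]: "\<mu> \<in> borel_measurable borel"
      unfolding \<mu>_def using K by (rule borel_measurable_minkowski_functional)
    show "f \<in> borel_measurable borel"
      unfolding f[abs_def] by measurable
    show "0 \<le> inverse \<delta>" using \<delta>(1) by simp
    fix x :: "real ^ 4"
    have "f x \<le> inverse \<delta> * inverse ((norm x)\<^sup>2)"
    proof (cases "x = 0")
      case True
      have "\<mu> 0 = 0"
        using minkowski_functional_attained(1)[OF K, of 0] minkowski_functional_attained(3)[OF K, of 0 0] K interior_subset unfolding \<mu>_def by force
      then show ?thesis using True by (simp add: f)
    next
      case False
      then have "inverse ((\<mu> x)\<^sup>2 - (norm x)\<^sup>2) \<le> inverse (\<delta> * (norm x)\<^sup>2)"
        using \<delta> by (intro le_imp_inverse_le) auto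
      then show ?thesis by (simp add: f)
    qed
    moreover have "sqrt (norm x) ^ DIM(real ^ 4) = (norm x)\<^sup>2"
      using power_mult[of "sqrt (norm x)" 2 2] by simp
    ultimately show "\<bar>f x\<bar> \<le> inverse \<delta> * inverse (sqrt (norm x) ^ DIM(real ^ 4))"
      using nonneg by simp
  qed
  moreover have "positive_definite (distribution_of f)"
  proof (rule positive_definite_distribution_of_complex_homogeneous)
    show "0 \<le> f x" for x by (rule nonneg)
    fix c z w :: complex assume c: "c \<noteq> 0"
    \<comment> \<open>a complex scalar is a rotation, under which \<open>f\<close> is invariant, times a dilation\<close>
    define \<theta> where "\<theta> = Arg2pi c"
    have polar: "c = of_real (norm c) * cis \<theta>" and \<theta>: "\<theta> \<in> {0..2 * pi}"
      using Arg2pi[of c] by (auto simp: \<theta>_def is_Arg_def cis_conv_exp)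
    have "realify (c * z, c * w) = norm c *\<^sub>R rot4 \<theta> (realify (z, w))"
    proof -
      have "c * v = norm c *\<^sub>R (cis \<theta> * v)" for v
        using polar by (metis mult.assoc scaleR_conv_of_real)
      then have "(c * z, c * w) = norm c *\<^sub>R (cis \<theta> * z, cis \<theta> * w)"
        by simp
      then show ?thesis
        by (simp add: rot4_realify linear_scale[OF linear_realify, symmetric] del: scaleR_Pair)
    qed
    moreover have "norm (rot4 \<theta> (realify (z, w))) = norm (realify (z, w))"
      by (simp add: rot4_realify norm_realify norm_prod_def norm_mult)
    moreover have "\<mu> (rot4 \<theta> x) = \<mu> x" for x
      using assms(2) \<theta> unfolding rotation_invariant_def \<mu>_def by metis
    moreover have "\<mu> (norm c *\<^sub>R x) = norm c * \<mu> x" for x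
      unfolding \<mu>_def using K c by (intro minkowski_functional_scaleR) simp_all
    ultimately have "f (realify (c * z, c * w))
        = inverse ((norm c)\<^sup>2 * ((\<mu> (realify (z, w)))\<^sup>2 - (norm (realify (z, w)))\<^sup>2))"
      by (simp add: f power_mult_distrib right_diff_distrib)
    then show "(norm c)\<^sup>2 * f (realify (c * z, c * w)) = f (realify (z, w))"
      using c by (simp add: f)
  qed
  ultimately show ?thesis ..
qed

end
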